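(* For any graph $G$, there exists $p\in\mathbb{N}$ such that $G\vee K_p$ is partially DP-nice.
   Context: All graphs are nonempty, finite and simple. For $m\in\mathbb{N}=\{1,2,\dots\}$ write $[m]=\{1,\dots,m\}$. $G_1\vee G_2$ denotes the join of vertex-disjoint graphs $G_1,G_2$ (their union together with all edges between $V(G_1)$ and $V(G_2)$), and $K_p$ is the complete graph on $p$ vertices. For $S,U\subseteq V(H)$, $E_H(S,U)$ is the set of edges of $H$ with at least one endpoint in $S$ and at least one endpoint in $U$. A cover of a graph $G$ is a pair $\mathcal{H}=(L,H)$ where $H$ is a graph and $L:V(G)\to\mathcal{P}(V(H))$ satisfies: (1) the sets $L(u)$, $u\in V(G)$, partition $V(H)$; (2) $H[L(u)]$ is complete for every $u\in V(G)$; (3) for every $uv\in E(G)$, $E_H(L(u),L(v))$ is a (possibly empty) matching; (4) if $u\neq v$ and $uv\notin E(G)$, then $E_H(L(u),L(v))=\emptyset$. The cover is $m$-fold if $|L(u)|=m$ for all $u\in V(G)$. An $\mathcal{H}$-coloring of $G$ is an independent set of size $|V(G)|$ in $H$. The DP-chromatic number $\chi_{DP}(G)$ is the smallest $m$ such that $G$ has an $\mathcal{H}$-coloring for every $m$-fold cover $\mathcal{H}$ of $G$. For $t\in\mathbb{N}$, the partial DP $t$-chromatic number $\alpha_t^{DP}(G)$ is the minimum of $\alpha(H)$ (the independence number of $H$) over all $t$-fold covers $\mathcal{H}=(L,H)$ of $G$. A graph $G$ is partially DP-nice if $\alpha_t^{DP}(G)\ge t|V(G)|/\chi_{DP}(G)$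 for all $t\in[\chi_{DP}(G)]$. *)

theory Defs
  imports Complex_Main "HOL-Library.Ramsey" "HOL-Library.Disjoint_Sets"
begin

record 'a ugraph =
  verts :: "'a set"
  edges :: "'a set set"

definition graph :: "'a ugraph \<Rightarrow> bool" where
  "graph G \<longleftrightarrow> verts G \<noteq> {} \<and> finite (verts G) \<and> edges G \<subseteq> [verts G]\<^bsup>2\<^esup>"

definition complete_graph :: "nat \<Rightarrow> nat ugraph" where
  "complete_graph p = \<lparr>verts = {1..p}, edges = [{1..p}]\<^bsup>2\<^esup>\<rparr>"

text \<open>The disjoint sum of the vertex types makes the two graphs vertex-disjoint.\<close>

definition join :: "'a ugraph \<Rightarrow> 'b ugraph \<Rightarrow> ('a + 'b) ugraph" where
  "join G1 G2 =
     \<lparr>verts = verts G1 <+> verts G2,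
      edges = (`) Inl ` edges G1 \<union> (`) Inr ` edges G2
              \<union> {{Inl u, Inr v} | u v. u \<in> verts G1 \<and> v \<in> verts G2}\<rparr>"

definition edges_between :: "'a ugraph \<Rightarrow> 'a set \<Rightarrow> 'a set \<Rightarrow> 'a set set" where
  "edges_between H S U = {e \<in> edges H. e \<inter> S \<noteq> {} \<and> e \<inter> U \<noteq> {}}"

definition independent_set :: "'a ugraph \<Rightarrow> 'a set \<Rightarrow> bool" where
  "independent_set H I \<longleftrightarrow> I \<subseteq> verts H \<and> indep I (edges H)"

definition independence_number :: "'a ugraph \<Rightarrow> nat" where
  "independence_number H = Max {card I | I. independent_set H I}"

text \<open>A set of edges is a matching iff its members are pairwise disjoint. The values of \<open>L\<close>
  outside \<open>verts G\<close> are irrelevant.\<close>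

definition cover :: "'a ugraph \<Rightarrow> ('a \<Rightarrow> 'b set) \<Rightarrow> 'b ugraph \<Rightarrow> bool" where
  "cover G L H \<longleftrightarrow>
     graph H \<and>
     (\<Union>u\<in>verts G. L u) = verts H \<and> disjoint_family_on L (verts G) \<and>
     (\<forall>u\<in>verts G. clique (L u) (edges H)) \<and>
     (\<forall>u v. {u, v} \<in> edges G \<longrightarrow> disjoint (edges_between H (L u) (L v))) \<and>
     (\<forall>u\<in>verts G. \<forall>v\<in>verts G. u \<noteq> v \<and> {u, v} \<notin> edges G \<longrightarrow>
        edges_between H (L u) (L v) = {})"

definition fold_cover :: "nat \<Rightarrow> 'a ugraph \<Rightarrow> ('a \<Rightarrow> 'b set) \<Rightarrow> 'b ugraph \<Rightarrow> bool" where
  "fold_cover m G L H \<longleftrightarrow> cover G L H \<and> (\<forall>u\<in>verts G. card (L u) = m)"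

definition cover_coloring :: "'a ugraph \<Rightarrow> 'b ugraph \<Rightarrow> 'b set \<Rightarrow> bool" where
  "cover_coloring G H I \<longleftrightarrow> independent_set H I \<and> card I = card (verts G)"

text \<open>Below, covers have vertices in \<open>nat\<close>, since types cannot be quantified inside a formula.
  As cover graphs are finite, this is no restriction: the lemma \<open>fold_cover_nat\<close> carries
  any cover over to \<open>nat\<close>.

  The index \<open>m\<close> ranges over the positive integers: cover graphs being nonempty, a 0-fold
  cover does not exist, so \<open>m = 0\<close> would satisfy the condition vacuously.\<close>

definition DP_chromatic_number :: "'a ugraph \<Rightarrow> nat" where
  "DP_chromatic_number G =
     (LEAST m. 1 \<le> m \<and>
        (\<forall>L (H :: nat ugraph). fold_cover m G L H \<longrightarrow> (\<exists>I. cover_coloring G H I)))"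

definition partial_DP_number :: "nat \<Rightarrow> 'a ugraph \<Rightarrow> nat" where
  "partial_DP_number t G =
     (LEAST a. \<exists>L (H :: nat ugraph). fold_cover t G L H \<and> a = independence_number H)"

definition partially_DP_nice :: "'a ugraph \<Rightarrow> bool" where
  "partially_DP_nice G \<longleftrightarrow>
     (\<forall>t\<in>{1..DP_chromatic_number G}.
        real (partial_DP_number t G)
          \<ge> real t * real (card (verts G)) / real (DP_chromatic_number G))"

definition map_graph :: "('b \<Rightarrow> 'c) \<Rightarrow> 'b ugraph \<Rightarrow> 'c ugraph" where
  "map_graph f H = \<lparr>verts = f ` verts H, edges = (`) f ` edges H\<rparr>"

lemma independent_set_map:
  assumes "graph H" "inj_on f (verts H)" "I \<subseteq> verts H"
  shows "independent_set (map_graph f H) (f ` I) \<longleftrightarrow> independent_set H I"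
proof -
  have sub: "e \<subseteq> verts H" if "e \<in> edges H" for e
    using assms(1) that by (auto simp: graph_def nsets_def)
  have "f ` {u, v} \<in> (`) f ` edges H \<longleftrightarrow> {u, v} \<in> edges H" if "u \<in> I" "v \<in> I" for u v
    using inj_on_image_eq_iff[OF assms(2)] sub that assms(3)
    by (smt (verit) imageE imageI insert_subset empty_subsetI subset_iff)
  moreover have "f u \<noteq> f v \<longleftrightarrow> u \<noteq> v" if "u \<in> I" "v \<in> I" for u v
    using assms(2,3) that by (auto dest: inj_onD)
  ultimately show ?thesis
    using assms(3) by (auto simp: independent_set_def map_graph_def indep_def)
qed

lemma fold_cover_map:
  assumes H: "fold_cover m G L H" and G: "graph G" and f: "inj_on f (verts H)"
  shows "fold_cover m G (\<lambda>u. f ` L u) (map_graph f H)"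
proof -
  have gH: "graph H" using H by (simp add: fold_cover_def cover_def)
  have sub: "e \<subseteq> verts H" if "e \<in> edges H" for e
    using gH that by (auto simp: graph_def nsets_def)
  have L: "L u \<subseteq> verts H" if "u \<in> verts G" for u
    using H that by (auto simp: fold_cover_def cover_def)
  have int: "f ` A \<inter> f ` B = f ` (A \<inter> B)" if "A \<subseteq> verts H" "B \<subseteq> verts H" for A B
    using inj_on_image_Int[OF f that] by simp
  have between: "edges_between (map_graph f H) (f ` S) (f ` U) = (`) f ` edges_between H S U"
    if "S \<subseteq> verts H" "U \<subseteq> verts H" for S U
  proof -
    have "f ` e \<inter> f ` S \<noteq> {} \<longleftrightarrow> e \<inter> S \<noteq> {}" "f ` e \<inter> f ` U \<noteq> {} \<longleftrightarrow> e \<inter> U \<noteq> {}"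
      if "e \<in> edges H" for e
      using int[OF sub[OF that] \<open>S \<subseteq> verts H\<close>] int[OF sub[OF that] \<open>U \<subseteq> verts H\<close>]
      by simp_all
    then show ?thesis
      unfolding edges_between_def map_graph_def by (auto simp del: image_is_empty)
  qed
  have ed: "u \<in> verts G \<and> v \<in> verts G" if "{u, v} \<in> edges G" for u v
    using G that by (auto simp: graph_def nsets_def)
  have "f ` e \<in> [f ` verts H]\<^bsup>2\<^esup>" if "e \<in> edges H" for e
    using that gH sub f card_image[OF inj_on_subset[OF f sub[OF that]]]
    by (auto simp: nsets_def graph_def)
  then have "graph (map_graph f H)"
    using gH by (auto simp: graph_def map_graph_def)
  moreover have "(\<Union>u\<in>verts G. f ` L u) = verts (map_graph f H)"
    using H by (simp add: fold_cover_def cover_def map_graph_def image_UN[symmetric])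
  moreover have "disjoint_family_on (\<lambda>u. f ` L u) (verts G)"
    using H L by (auto simp: fold_cover_def cover_def disjoint_family_on_def int)
  moreover have "clique (f ` L u) (edges (map_graph f H))" if "u \<in> verts G" for u
    unfolding clique_def
  proof (intro ballI impI)
    fix x y assume "x \<in> f ` L u" "y \<in> f ` L u" "x \<noteq> y"
    then obtain a b where ab: "a \<in> L u" "b \<in> L u" "a \<noteq> b" "x = f a" "y = f b" by auto
    then have "{a, b} \<in> edges H"
      using H that by (simp add: fold_cover_def cover_def clique_def)
    moreover have "{x, y} = f ` {a, b}" using ab by simp
    ultimately show "{x, y} \<in> edges (map_graph f H)"
      unfolding map_graph_def by (simp only: ugraph.simps image_eqI)
  qed
  moreover have "disjoint (edges_between (map_graph f H) (f ` L u) (f ` L v))"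
    if "{u, v} \<in> edges G" for u v
  proof -
    have d: "disjoint (edges_between H (L u) (L v))"
      using H that by (auto simp: fold_cover_def cover_def)
    have "f ` a \<inter> f ` b = {}"
      if "a \<in> edges_between H (L u) (L v)" "b \<in> edges_between H (L u) (L v)" "f ` a \<noteq> f ` b"
      for a b
    proof -
      have "a \<inter> b = {}" using d that by (auto simp: disjoint_def)
      then show ?thesis using int[of a b] that sub by (auto simp: edges_between_def)
    qed
    then show ?thesis
      using ed[OF that] L by (auto simp: between disjoint_def)
  qed
  moreover have "edges_between (map_graph f H) (f ` L u) (f ` L v) = {}"
    if "u \<in> verts G" "v \<in> verts G" "u \<noteq> v" "{u, v} \<notin> edges G" for u v
    using H L that by (simp add: between fold_cover_def cover_def)
  moreover have "card (f ` L u) = m" if "u \<in> verts G" for u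
    using H that card_image[OF inj_on_subset[OF f L[OF that]]] by (simp add: fold_cover_def)
  ultimately show ?thesis
    by (simp add: fold_cover_def cover_def)
qed

lemma fold_cover_nat:
  fixes H :: "'b ugraph"
  assumes H: "fold_cover m G L H" and G: "graph G"
  obtains L' and H' :: "nat ugraph" where
    "fold_cover m G L' H'"
    "independence_number H' = independence_number H"
    "(\<exists>I. cover_coloring G H' I) \<longleftrightarrow> (\<exists>I. cover_coloring G H I)"
proof -
  have gH: "graph H" using H by (simp add: fold_cover_def cover_def)
  then obtain f :: "'b \<Rightarrow> nat" where f: "inj_on f (verts H)"
    using finite_imp_inj_to_nat_seg[of "verts H"] by (auto simp: graph_def)
  have card_f: "card (f ` I) = card I" if "I \<subseteq> verts H" for I
    using card_image[OF inj_on_subset[OF f that]] .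
  have cards: "(\<exists>I. independent_set (map_graph f H) I \<and> card I = n)
      \<longleftrightarrow> (\<exists>I. independent_set H I \<and> card I = n)" for n
  proof
    assume "\<exists>I. independent_set (map_graph f H) I \<and> card I = n"
    then obtain J where J: "independent_set (map_graph f H) J" "card J = n" by blast
    then obtain I where "I \<subseteq> verts H" "J = f ` I"
      by (auto simp: independent_set_def map_graph_def subset_image_iff)
    then show "\<exists>I. independent_set H I \<and> card I = n"
      using J card_f independent_set_map[OF gH f] by auto
  next
    assume "\<exists>I. independent_set H I \<and> card I = n"
    then obtain I where I: "independent_set H I" "card I = n" by blast
    then have "I \<subseteq> verts H" by (simp add: independent_set_def)
    then show "\<exists>I. independent_set (map_graph f H) I \<and> card I = n"
      using I card_f independent_set_map[OF gH f] by blast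
  qed
  have "{card I | I. independent_set (map_graph f H) I} = {card I | I. independent_set H I}"
    using cards by (auto simp: set_eq_iff) metis+
  then have "independence_number (map_graph f H) = independence_number H"
    by (simp add: independence_number_def)
  moreover have "(\<exists>I. cover_coloring G (map_graph f H) I) \<longleftrightarrow> (\<exists>I. cover_coloring G H I)"
    using cards by (simp add: cover_coloring_def)
  ultimately show thesis
    using that fold_cover_map[OF H G f] by blast
qed

end

theory Submission
  imports Defs
begin

text \<open>Write \<open>D p\<close> for the DP-chromatic number of \<open>G \<or> K\<^sub>p\<close> and \<open>n\<close> for the order of \<open>G\<close>. Removing a
  coloured vertex of \<open>K\<^sub>p\<^sub>+\<^sub>1\<close> costs every other vertex at most one colour, so
  \<open>D (p + 1) \<le> D p + 1\<close>; as \<open>D p \<ge> p\<close>, the difference \<open>D p - p\<close> has a constant value \<open>s\<close> for all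
  \<open>p \<ge> p\<^sub>0\<close>. Let \<open>p\<close> be large. If \<open>t \<ge> p\<^sub>0 + s\<close>, the induced subgraph \<open>G \<or> K\<^bsub>t-s\<^esub>\<close> of \<open>G \<or> K\<^sub>p\<close> has
  DP-chromatic number \<open>t\<close>, so every \<open>t\<close>-fold cover has an independent set of size
  \<open>n + t - s \<ge> t (n + p) / (p + s)\<close>. For the remaining, bounded \<open>t\<close> the required bound is at most
  \<open>t + 1\<close>, which greedy colouring attains on two non-adjacent vertices of \<open>G\<close> together with
  \<open>t - 1\<close> others. If \<open>G\<close> is complete, then \<open>s = n\<close> and the greedy bound \<open>t\<close> is enough.\<close>

section \<open>Induced subgraphs and restrictions of covers\<close>

definition induced :: "'a ugraph \<Rightarrow> 'a set \<Rightarrow> 'a ugraph" where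
  "induced G W = \<lparr>verts = W, edges = {e \<in> edges G. e \<subseteq> W}\<rparr>"

lemma verts_induced [simp]: "verts (induced G W) = W"
  by (simp add: induced_def)

lemma graph_edgeD:
  assumes "graph G" "{u, v} \<in> edges G"
  shows "u \<noteq> v" "u \<in> verts G" "v \<in> verts G"
  using assms by (auto simp: graph_def nsets_def)

lemma graph_induced:
  assumes "graph G" "W \<subseteq> verts G" "W \<noteq> {}"
  shows "graph (induced G W)"
  using assms finite_subset[OF assms(2)] by (auto simp: graph_def induced_def nsets_def)

lemma independent_set_induced:
  assumes "independent_set (induced H S) I" "S \<subseteq> verts H"
  shows "independent_set H I"
  using assms unfolding independent_set_def induced_def indep_def by simp blast

lemma cover_graph: "cover G L H \<Longrightarrow> graph H"
  by (simp add: cover_def)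

lemma cover_subset: "cover G L H \<Longrightarrow> u \<in> verts G \<Longrightarrow> L u \<subseteq> verts H"
  by (auto simp: cover_def)

lemma cover_disjoint:
  "cover G L H \<Longrightarrow> u \<in> verts G \<Longrightarrow> v \<in> verts G \<Longrightarrow> u \<noteq> v \<Longrightarrow> L u \<inter> L v = {}"
  by (auto simp: cover_def disjoint_family_on_def)

lemma cover_clique:
  "cover G L H \<Longrightarrow> u \<in> verts G \<Longrightarrow> x \<in> L u \<Longrightarrow> y \<in> L u \<Longrightarrow> x \<noteq> y \<Longrightarrow> {x, y} \<in> edges H"
  by (auto simp: cover_def clique_def)

text \<open>Both edges at \<open>x\<close> lie in the matching between \<open>L u\<close> and
  \<open>L v\<close>; since they meet, they coincide.\<close>

lemma cover_matching:
  assumes "cover G L H" "{u, v} \<in> edges G" "x \<in> L u" "y \<in> L v" "z \<in> L v"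
    and "{x, y} \<in> edges H" "{x, z} \<in> edges H"
  shows "y = z"
proof -
  have "{x, y} \<in> edges_between H (L u) (L v)" "{x, z} \<in> edges_between H (L u) (L v)"
    using assms by (auto simp: edges_between_def)
  moreover have "disjoint (edges_between H (L u) (L v))"
    using assms by (auto simp: cover_def)
  ultimately have "{x, y} = {x, z}"
    by (metis disjointD insert_disjoint(1) insertI1)
  then show ?thesis by (auto simp: doubleton_eq_iff)
qed

lemma cover_edge:
  assumes "cover G L H" "u \<in> verts G" "v \<in> verts G" "u \<noteq> v"
    and "x \<in> L u" "y \<in> L v" "{x, y} \<in> edges H"
  shows "{u, v} \<in> edges G"
proof (rule ccontr)
  assume "{u, v} \<notin> edges G"
  then have "edges_between H (L u) (L v) = {}"
    using assms unfolding cover_def by blast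
  then show False
    using assms by (auto simp: edges_between_def)
qed

text \<open>Dropping vertices of \<open>G\<close> and shrinking lists only removes edges between
  lists, so matchings stay matchings. It serves twice: with \<open>L' = L\<close> to pass to an
  induced subgraph, and with shorter lists after one vertex has been coloured. The hypothesis
  \<open>ne\<close> is there because \<open>graph\<close> excludes the empty graph.\<close>

lemma cover_restrict:
  assumes H: "cover G L H" and W: "W \<subseteq> verts G"
    and L': "\<And>u. u \<in> W \<Longrightarrow> L' u \<subseteq> L u" and ne: "(\<Union>u\<in>W. L' u) \<noteq> {}"
  shows "cover (induced G W) L' (induced H (\<Union>u\<in>W. L' u))"
proof -
  let ?S = "\<Union>u\<in>W. L' u"
  have S: "?S \<subseteq> verts H" using cover_subset[OF H] W L' by blast
  have sub: "edges_between (induced H ?S) (L' u) (L' v) \<subseteq> edges_between H (L u) (L v)"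
    if "u \<in> W" "v \<in> W" for u v
    using L' that by (auto simp: edges_between_def induced_def)
  have "graph (induced H ?S)"
    using graph_induced[OF cover_graph[OF H] S ne] .
  moreover have "disjoint_family_on L' W"
    unfolding disjoint_family_on_def using cover_disjoint[OF H] W L' by (metis disjoint_iff subsetD)
  moreover have "clique (L' u) (edges (induced H ?S))" if "u \<in> W" for u
    using cover_clique[OF H, of u] L'[OF that] W that
    by (auto simp: clique_def induced_def)
  moreover have "disjoint (edges_between (induced H ?S) (L' u) (L' v))"
    if "{u, v} \<in> edges (induced G W)" for u v
  proof -
    have "disjoint (edges_between H (L u) (L v))" "u \<in> W" "v \<in> W"
      using H that by (auto simp: cover_def induced_def)
    then show ?thesis using sub[of u v] by (meson pairwise_subset)
  qed
  moreover have "edges_between (induced H ?S) (L' u) (L' v) = {}"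
    if "u \<in> W" "v \<in> W" "u \<noteq> v" "{u, v} \<notin> edges (induced G W)" for u v
  proof -
    have "u \<in> verts G" "v \<in> verts G" "{u, v} \<notin> edges G"
      using that W by (auto simp: induced_def)
    then have "edges_between H (L u) (L v) = {}"
      using H that(3) unfolding cover_def by blast
    then show ?thesis using sub[OF that(1,2)] by simp
  qed
  ultimately show ?thesis
    by (auto simp: cover_def induced_def)
qed

lemma independence_number_ge:
  assumes "graph H" "independent_set H I"
  shows "card I \<le> independence_number H"
  unfolding independence_number_def
proof (rule Max_ge)
  have "{I. independent_set H I} \<subseteq> Pow (verts H)"
    by (auto simp: independent_set_def)
  then have "finite {I. independent_set H I}"
    using assms(1) by (meson finite_Pow_iff finite_subset graph_def)
  then show "finite {card I | I. independent_set H I}" by simp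
qed (use assms in auto)

subsection \<open>Greedy colouring\<close>

text \<open>Independent transversals are encoded as choice functions, so that a greedy step is a
  function update.\<close>

definition partial_coloring ::
    "('a \<Rightarrow> 'b set) \<Rightarrow> 'b ugraph \<Rightarrow> 'a set \<Rightarrow> ('a \<Rightarrow> 'b) \<Rightarrow> bool" where
  "partial_coloring L H W f \<longleftrightarrow>
     (\<forall>v\<in>W. f v \<in> L v) \<and> (\<forall>v\<in>W. \<forall>w\<in>W. {f v, f w} \<notin> edges H)"

lemma partial_coloring_independent:
  assumes H: "cover G L H" and W: "W \<subseteq> verts G" and f: "partial_coloring L H W f"
  shows "independent_set H (f ` W)" "card (f ` W) = card W"
proof -
  show "independent_set H (f ` W)"
    using f W cover_subset[OF H] by (fastforce simp: partial_coloring_def independent_set_def indep_def)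
  have "inj_on f W"
  proof (rule inj_onI, rule ccontr)
    fix u v assume uv: "u \<in> W" "v \<in> W" "f u = f v" "u \<noteq> v"
    then have "f u \<in> L u" "f u \<in> L v" using f by (auto simp: partial_coloring_def)
    moreover have "L u \<inter> L v = {}" using cover_disjoint[OF H] uv W by blast
    ultimately show False by blast
  qed
  then show "card (f ` W) = card W" by (rule card_image)
qed

text \<open>By the matching condition each coloured neighbour of \<open>u\<close> forbids at most
  one colour of \<open>L u\<close>, and a non-neighbour forbids none. With fewer coloured neighbours
  than colours, some colour remains free.\<close>

lemma partial_coloring_extend:
  assumes H: "cover G L H" and W: "W \<subseteq> verts G" "finite W" and f: "partial_coloring L H W f"
    and u: "u \<in> verts G" "u \<notin> W" and less: "card {v \<in> W. {u, v} \<in> edges G} < card (L u)"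
  shows "\<exists>f. partial_coloring L H (insert u W) f"
proof -
  let ?N = "{v \<in> W. {u, v} \<in> edges G}"
  let ?B = "\<lambda>v. {c \<in> L u. {f v, c} \<in> edges H}"
  have fL: "f v \<in> L v" if "v \<in> W" for v
    using f that by (auto simp: partial_coloring_def)
  \<comment> \<open>An infinite \<open>L u\<close> would have cardinality 0, contradicting
    \<open>less\<close>.\<close>
  have finL: "finite (L u)" using less by (metis card.infinite not_less0)
  have B: "card (?B v) \<le> Suc 0" if "v \<in> ?N" for v
  proof -
    have "{v, u} \<in> edges G" "v \<in> W" using that by (simp_all add: insert_commute)
    then show ?thesis
      using cover_matching[OF H, of v u "f v"] fL finL by (auto simp: card_le_Suc0_iff_eq)
  qed
  have "card (\<Union>v\<in>?N. ?B v) \<le> (\<Sum>v\<in>?N. card (?B v))"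
    using W(2) by (intro card_UN_le) auto
  also have "\<dots> \<le> (\<Sum>v\<in>?N. 1)"
    using B by (intro sum_mono) simp
  finally have "card (\<Union>v\<in>?N. ?B v) < card (L u)"
    using less by simp
  moreover have "finite (\<Union>v\<in>?N. ?B v)"
    using finL by (rule finite_subset[rotated]) blast
  ultimately have "\<not> L u \<subseteq> (\<Union>v\<in>?N. ?B v)"
    using card_mono leD by blast
  then obtain c where c: "c \<in> L u" "\<And>v. v \<in> ?N \<Longrightarrow> {f v, c} \<notin> edges H"
    by blast
  have c': "{f v, c} \<notin> edges H" if "v \<in> W" for v
  proof
    assume "{f v, c} \<in> edges H"
    then have "{v, u} \<in> edges G"
      using cover_edge[OF H _ u(1) _ fL[OF that] c(1)] that u W by blast
    then show False
      using c(2)[of v] that \<open>{f v, c} \<in> edges H\<close> by (simp add: insert_commute)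
  qed
  moreover have "{c, c} \<notin> edges H"
    using graph_edgeD(1)[OF cover_graph[OF H]] by blast
  ultimately have "partial_coloring L H (insert u W) (f(u := c))"
    using f u(2) c(1) by (auto simp: partial_coloring_def insert_commute)
  then show ?thesis by blast
qed

lemma partial_coloring_greedy:
  assumes H: "fold_cover m G L H" and "finite W" "W \<subseteq> verts G" "card W \<le> m"
  shows "\<exists>f. partial_coloring L H W f"
  using assms(2-)
proof (induction W rule: finite_induct)
  case empty
  then show ?case by (simp add: partial_coloring_def)
next
  case (insert u W)
  then obtain f where f: "partial_coloring L H W f" by auto
  have "card {v \<in> W. {u, v} \<in> edges G} \<le> card W"
    using insert by (intro card_mono) auto
  then show ?case
    using partial_coloring_extend[of G L H W f u] H f insert by (auto simp: fold_cover_def)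
qed

text \<open>Among any \<open>m\<close> vertices each meets at most \<open>m - 1\<close> coloured
  neighbours, so greedy colouring does not get stuck.\<close>

lemma fold_cover_independence_ge:
  assumes H: "fold_cover m G L H" and m: "m \<le> card (verts G)"
  shows "m \<le> independence_number H"
proof -
  obtain W where W: "W \<subseteq> verts G" "card W = m" "finite W"
    using obtain_subset_with_card_n[OF m] by metis
  have "cover G L H" using H by (simp add: fold_cover_def)
  then show ?thesis
    using partial_coloring_greedy[OF H W(3,1)] W partial_coloring_independent
      independence_number_ge cover_graph by (metis order_refl)
qed

text \<open>Colour \<open>m - 1\<close> other vertices, then \<open>u\<close>, then
  \<open>v\<close>. When \<open>v\<close> is reached, \<open>m\<close> vertices are coloured, but
  \<open>u\<close> is not a neighbour of \<open>v\<close>, so one of the \<open>m\<close> colours in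
  \<open>L v\<close> is still free.\<close>

lemma fold_cover_independence_ge_Suc:
  assumes H: "fold_cover m G L H" and m: "1 \<le> m" "m < card (verts G)"
    and uv: "u \<in> verts G" "v \<in> verts G" "u \<noteq> v" "{u, v} \<notin> edges G"
  shows "Suc m \<le> independence_number H"
proof -
  have cov: "cover G L H" and card_L: "\<And>w. w \<in> verts G \<Longrightarrow> card (L w) = m"
    using H by (auto simp: fold_cover_def)
  have "m - 1 \<le> card (verts G - {u, v})"
    using uv m by (simp add: card_Diff_subset)
  then obtain W where W: "W \<subseteq> verts G - {u, v}" "card W = m - 1" "finite W"
    by (rule obtain_subset_with_card_n)
  obtain f where f: "partial_coloring L H W f"
    using partial_coloring_greedy[OF H W(3)] W by auto
  have "card {w \<in> W. {u, w} \<in> edges G} \<le> card W"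
    using W by (intro card_mono) auto
  then obtain g where g: "partial_coloring L H (insert u W) g"
    using partial_coloring_extend[OF cov _ W(3) f, of u] W uv card_L m by fastforce
  have "{w \<in> insert u W. {v, w} \<in> edges G} \<subseteq> W"
    using uv by (auto simp: insert_commute)
  then have "card {w \<in> insert u W. {v, w} \<in> edges G} \<le> card W"
    using W by (intro card_mono) auto
  then obtain h where h: "partial_coloring L H (insert v (insert u W)) h"
    using partial_coloring_extend[OF cov _ _ g, of v] W uv card_L m by fastforce
  have "card (insert v (insert u W)) = Suc m"
    using W uv m by (auto simp: card_insert_if)
  moreover have "insert v (insert u W) \<subseteq> verts G" using W uv by auto
  ultimately show ?thesis
    using partial_coloring_independent[OF cov _ h] independence_number_ge cover_graph[OF cov]
    by metis
qed

subsection \<open>The parallel cover\<close>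

text \<open>This is the Cartesian product of \<open>G\<close> with the complete graph on
  \<open>m\<close> vertices; its cover colourings are the proper \<open>m\<close>-colourings of
  \<open>G\<close>. It shows that \<open>m\<close>-fold covers exist and bounds the DP-chromatic
  number below by clique sizes.\<close>

definition parallel_cover :: "nat \<Rightarrow> 'a ugraph \<Rightarrow> ('a \<times> nat) ugraph" where
  "parallel_cover m G =
     \<lparr>verts = verts G \<times> {..<m},
      edges = {{(u, i), (u, j)} | u i j. u \<in> verts G \<and> i < m \<and> j < m \<and> i \<noteq> j}
              \<union> {{(u, i), (v, i)} | u v i. {u, v} \<in> edges G \<and> i < m}\<rparr>"

lemma fold_cover_parallel:
  assumes G: "graph G" and m: "1 \<le> m"
  shows "fold_cover m G (\<lambda>u. {u} \<times> {..<m}) (parallel_cover m G)"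
proof -
  note E = graph_edgeD[OF G]
  let ?H = "parallel_cover m G"
  \<comment> \<open>An edge between different lists stays on one level \<open>i\<close>, so two such
    edges between the same lists are equal or disjoint.\<close>
  have edge: "\<exists>i<m. e = {(u, i), (v, i)} \<and> {u, v} \<in> edges G"
    if "e \<in> edges_between ?H ({u} \<times> {..<m}) ({v} \<times> {..<m})" "u \<noteq> v" for e u v
    using that by (auto simp: parallel_cover_def edges_between_def insert_commute)
  have "edges ?H \<subseteq> [verts ?H]\<^bsup>2\<^esup>"
    using E by (auto simp: parallel_cover_def nsets_def card_insert_if)
  moreover have "verts ?H \<noteq> {}" "finite (verts ?H)"
    using G m by (auto simp: parallel_cover_def graph_def lessThan_empty_iff)
  ultimately have "graph ?H" by (simp add: graph_def)
  moreover have "disjoint (edges_between ?H ({u} \<times> {..<m}) ({v} \<times> {..<m}))"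
    if "{u, v} \<in> edges G" for u v
  proof (rule disjointI)
    fix a b assume ab: "a \<in> edges_between ?H ({u} \<times> {..<m}) ({v} \<times> {..<m})"
      "b \<in> edges_between ?H ({u} \<times> {..<m}) ({v} \<times> {..<m})" "a \<noteq> b"
    have "u \<noteq> v" using E(1) \<open>{u, v} \<in> edges G\<close> .
    obtain i where "a = {(u, i), (v, i)}" using edge[OF ab(1) \<open>u \<noteq> v\<close>] by blast
    moreover obtain j where "b = {(u, j), (v, j)}" using edge[OF ab(2) \<open>u \<noteq> v\<close>] by blast
    ultimately show "a \<inter> b = {}" using ab(3) by auto
  qed
  moreover have "edges_between ?H ({u} \<times> {..<m}) ({v} \<times> {..<m}) = {}"
    if "u \<noteq> v" "{u, v} \<notin> edges G" for u v
    using edge that by blast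
  moreover have "clique ({u} \<times> {..<m}) (edges ?H)" if "u \<in> verts G" for u
    using that by (auto simp: clique_def parallel_cover_def)
  moreover have "(\<Union>u\<in>verts G. {u} \<times> {..<m}) = verts ?H"
    by (auto simp: parallel_cover_def)
  ultimately show ?thesis
    by (auto simp: fold_cover_def cover_def disjoint_family_on_def)
qed

text \<open>Lists are cliques, so \<open>I\<close> has at most one vertex in each. Sending a vertex
  to the owner of its list is thus injective on \<open>I\<close>, and by cardinality onto
  \<open>verts G\<close>.\<close>

lemma coloring_meets:
  assumes H: "cover G L H" and G: "graph G" and I: "cover_coloring G H I" and u: "u \<in> verts G"
  shows "\<exists>x\<in>I. x \<in> L u"
proof -
  have ind: "I \<subseteq> verts H" "indep I (edges H)" and card_I: "card I = card (verts G)"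
    using I by (auto simp: cover_coloring_def independent_set_def)
  have fin: "finite (verts G)" using G by (simp add: graph_def)
  have "\<forall>x\<in>I. \<exists>v\<in>verts G. x \<in> L v"
    using ind H by (auto simp: cover_def)
  then obtain g where g: "\<And>x. x \<in> I \<Longrightarrow> g x \<in> verts G \<and> x \<in> L (g x)" by metis
  have "inj_on g I"
    using g ind(2) cover_clique[OF H] by (metis indep_def inj_onI)
  then have "g ` I = verts G"
    using card_subset_eq[OF fin, of "g ` I"] g card_I card_image by (metis image_subsetI)
  then show ?thesis using g u by (metis imageE)
qed

text \<open>The levels chosen by \<open>I\<close> form a proper colouring of \<open>G\<close> with
  \<open>m\<close> colours, which is injective on a clique.\<close>

lemma parallel_coloring_clique_le:
  assumes G: "graph G" and I: "cover_coloring G (parallel_cover m G) I" and m: "1 \<le> m"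
    and W: "W \<subseteq> verts G" "clique W (edges G)"
  shows "card W \<le> m"
proof -
  have cov: "cover G (\<lambda>u. {u} \<times> {..<m}) (parallel_cover m G)"
    using fold_cover_parallel[OF G m] by (simp add: fold_cover_def)
  have "\<forall>u\<in>W. \<exists>i<m. (u, i) \<in> I"
    using coloring_meets[OF cov G I] W by fastforce
  then obtain c where c: "\<And>u. u \<in> W \<Longrightarrow> c u < m \<and> (u, c u) \<in> I" by metis
  have ind: "indep I (edges (parallel_cover m G))"
    using I by (simp add: cover_coloring_def independent_set_def)
  have "inj_on c W"
  proof (rule inj_onI, rule ccontr)
    fix u v assume uv: "u \<in> W" "v \<in> W" "c u = c v" "u \<noteq> v"
    then have "{u, v} \<in> edges G" using W(2) by (simp add: clique_def)
    then have "{(u, c u), (v, c u)} \<in> edges (parallel_cover m G)"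
      using c[OF uv(1)] unfolding parallel_cover_def by auto
    then show False
      using ind c[OF uv(1)] c[OF uv(2)] uv(3,4) unfolding indep_def by fastforce
  qed
  then have "card W \<le> card {..<m}"
    using c by (intro card_inj_on_le) auto
  then show ?thesis by simp
qed

subsection \<open>The DP-chromatic number\<close>

text \<open>The condition under \<open>LEAST\<close> in \<open>DP_chromatic_number\<close>.\<close>

definition DP_colorable :: "nat \<Rightarrow> 'a ugraph \<Rightarrow> bool" where
  "DP_colorable m G \<longleftrightarrow>
     1 \<le> m \<and> (\<forall>L (H :: nat ugraph). fold_cover m G L H \<longrightarrow> (\<exists>I. cover_coloring G H I))"

lemma DP_chromatic_number_le: "DP_colorable m G \<Longrightarrow> DP_chromatic_number G \<le> m"
  unfolding DP_chromatic_number_def DP_colorable_def by (rule Least_le)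

text \<open>Greedy colouring of all vertices succeeds. This provides the witness that makes the
  \<open>LEAST\<close> in \<open>DP_chromatic_number\<close> meaningful.\<close>

lemma DP_colorable_order:
  assumes G: "graph G"
  shows "DP_colorable (card (verts G)) G"
proof -
  have fin: "finite (verts G)" "verts G \<noteq> {}" using G by (auto simp: graph_def)
  have "\<exists>I. cover_coloring G H I" if H: "fold_cover (card (verts G)) G L H" for L and H :: "nat ugraph"
  proof -
    obtain f where "partial_coloring L H (verts G) f"
      using partial_coloring_greedy[OF H fin(1)] by auto
    then show ?thesis
      using partial_coloring_independent[of G L H "verts G" f] H
      by (auto simp: fold_cover_def cover_coloring_def)
  qed
  then show ?thesis
    using fin by (auto simp: DP_colorable_def Suc_le_eq card_gt_0_iff)
qed

lemma DP_colorable_chromatic_number: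
  assumes "graph G"
  shows "DP_colorable (DP_chromatic_number G) G"
  using LeastI[of "\<lambda>m. DP_colorable m G", OF DP_colorable_order[OF assms]]
  unfolding DP_chromatic_number_def DP_colorable_def .

lemma clique_le_DP_chromatic_number:
  assumes G: "graph G" and W: "W \<subseteq> verts G" "clique W (edges G)"
  shows "card W \<le> DP_chromatic_number G"
proof -
  let ?m = "DP_chromatic_number G"
  have col: "DP_colorable ?m G" using DP_colorable_chromatic_number[OF G] .
  then have m: "1 \<le> ?m" by (simp add: DP_colorable_def)
  obtain L' and H' :: "nat ugraph" where H': "fold_cover ?m G L' H'"
    "(\<exists>I. cover_coloring G H' I) \<longleftrightarrow> (\<exists>I. cover_coloring G (parallel_cover ?m G) I)"
    using fold_cover_nat[OF fold_cover_parallel[OF G m] G] by metis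
  then obtain I where "cover_coloring G (parallel_cover ?m G) I"
    using col by (auto simp: DP_colorable_def)
  then show ?thesis using parallel_coloring_clique_le[OF G _ m W] by blast
qed

text \<open>The minimum is over a nonempty set, because a copy of the parallel cover on
  \<open>nat\<close> is a \<open>t\<close>-fold cover; so it is attained and inherits the
  bound.\<close>

lemma partial_DP_number_ge:
  assumes G: "graph G" and t: "1 \<le> t"
    and ge: "\<And>L (H :: nat ugraph). fold_cover t G L H \<Longrightarrow> k \<le> independence_number H"
  shows "k \<le> partial_DP_number t G"
proof -
  obtain L' and H' :: "nat ugraph" where "fold_cover t G L' H'"
    using fold_cover_nat[OF fold_cover_parallel[OF G t] G] by metis
  then have "\<exists>a L (H :: nat ugraph). fold_cover t G L H \<and> a = independence_number H" by blast
  from LeastI_ex[OF this] show ?thesis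
    unfolding partial_DP_number_def using ge by auto
qed

text \<open>Restrict any \<open>t\<close>-fold cover to the lists over \<open>W\<close>: a colouring
  of the restriction is an independent set of the whole cover graph.\<close>

lemma partial_DP_number_ge_induced:
  assumes G: "graph G" and W: "W \<subseteq> verts G" "W \<noteq> {}" and col: "DP_colorable t (induced G W)"
  shows "card W \<le> partial_DP_number t G"
proof -
  have t: "1 \<le> t" using col by (simp add: DP_colorable_def)
  show ?thesis
  proof (rule partial_DP_number_ge[OF G t])
    fix L and H :: "nat ugraph" assume H: "fold_cover t G L H"
    then have cov: "cover G L H" and card_L: "\<And>u. u \<in> verts G \<Longrightarrow> card (L u) = t"
      by (auto simp: fold_cover_def)
    obtain u where "u \<in> W" using W(2) by blast
    moreover from this have "L u \<noteq> {}" using card_L[of u] W(1) t by auto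
    ultimately have "(\<Union>u\<in>W. L u) \<noteq> {}" by blast
    from cover_restrict[OF cov W(1) _ this]
    have "fold_cover t (induced G W) L (induced H (\<Union>u\<in>W. L u))"
      using W card_L by (auto simp: fold_cover_def)
    then obtain I where "cover_coloring (induced G W) (induced H (\<Union>u\<in>W. L u)) I"
      using col by (auto simp: DP_colorable_def)
    moreover have "(\<Union>u\<in>W. L u) \<subseteq> verts H"
      using cover_subset[OF cov] W by blast
    ultimately have "independent_set H I" "card I = card W"
      by (auto simp: cover_coloring_def intro: independent_set_induced)
    then show "card W \<le> independence_number H"
      using independence_number_ge[OF cover_graph[OF cov]] by metis
  qed
qed

text \<open>Give \<open>w\<close> any colour \<open>c\<close>. Every other list contains at most one
  neighbour of \<open>c\<close>; without it at least \<open>m\<close> colours remain, and a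
  colouring of the rest from these extends by \<open>c\<close>.\<close>

lemma DP_colorable_add_vertex:
  assumes G: "graph G" and w: "w \<in> verts G" "verts G - {w} \<noteq> {}"
    and col: "DP_colorable m (induced G (verts G - {w}))"
  shows "DP_colorable (Suc m) G"
  unfolding DP_colorable_def
proof (intro conjI allI impI)
  fix L and H :: "nat ugraph" assume H: "fold_cover (Suc m) G L H"
  then have cov: "cover G L H" and card_L: "\<And>u. u \<in> verts G \<Longrightarrow> card (L u) = Suc m"
    by (auto simp: fold_cover_def)
  let ?W = "verts G - {w}"
  obtain c where c: "c \<in> L w"
    using card_L[OF w(1)] by (metis card.empty ex_in_conv nat.distinct(1))
  let ?B = "\<lambda>u. {x \<in> L u. {c, x} \<in> edges H}"
  \<comment> \<open>Lists are trimmed to exactly \<open>m\<close>, since \<open>fold_cover\<close>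
    wants equal sizes and a list without a neighbour of \<open>c\<close> would keep
    \<open>Suc m\<close> colours.\<close>
  have "\<exists>A \<subseteq> L u - ?B u. card A = m" if u: "u \<in> ?W" for u
  proof -
    have fin: "finite (L u)" using card_L u by (metis DiffD1 card.infinite nat.distinct(1))
    have "y = z" if yz: "y \<in> ?B u" "z \<in> ?B u" for y z
    proof -
      have "{w, u} \<in> edges G"
        using cover_edge[OF cov w(1), of u c y] c u yz by blast
      then show ?thesis using cover_matching[OF cov _ c] yz by blast
    qed
    then have "card (?B u) \<le> 1"
      using fin by (auto simp: card_le_Suc0_iff_eq)
    moreover have "card (L u - ?B u) = card (L u) - card (?B u)"
      using fin by (intro card_Diff_subset) auto
    ultimately have "m \<le> card (L u - ?B u)"
      using card_L[of u] u by simp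
    then show ?thesis using obtain_subset_with_card_n by blast
  qed
  then have "\<exists>L'. \<forall>u\<in>?W. L' u \<subseteq> L u - ?B u \<and> card (L' u) = m"
    by (intro bchoice) blast
  then obtain L' where L': "\<And>u. u \<in> ?W \<Longrightarrow> L' u \<subseteq> L u - ?B u" "\<And>u. u \<in> ?W \<Longrightarrow> card (L' u) = m"
    by blast
  let ?S = "\<Union>u\<in>?W. L' u"
  have "1 \<le> m" using col by (simp add: DP_colorable_def)
  obtain u where u: "u \<in> ?W" using w(2) by blast
  then have "L' u \<noteq> {}" using L'(2)[of u] \<open>1 \<le> m\<close> by auto
  then have "?S \<noteq> {}" using u by blast
  then have "fold_cover m (induced G ?W) L' (induced H ?S)"
    using cover_restrict[OF cov, of ?W L'] L' by (auto simp: fold_cover_def)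
  then obtain I where I: "cover_coloring (induced G ?W) (induced H ?S) I"
    using col by (auto simp: DP_colorable_def)
  have S: "?S \<subseteq> verts H" using cover_subset[OF cov] L' by blast
  have I_S: "I \<subseteq> ?S"
    using I by (auto simp: cover_coloring_def independent_set_def induced_def)
  have ind: "independent_set H I"
    using I S by (auto simp: cover_coloring_def intro: independent_set_induced)
  have no: "{c, x} \<notin> edges H" if "x \<in> I" for x
    using that I_S L' by blast
  have "{c, c} \<notin> edges H" "finite (verts H)"
    using cover_graph[OF cov] by (auto simp: graph_def nsets_def)
  moreover have "c \<in> verts H" using cover_subset[OF cov w(1)] c by blast
  ultimately have ind': "independent_set H (insert c I)"
    using ind no by (auto simp: independent_set_def indep_def insert_commute)
  have "c \<notin> I"
    using I_S L'(1) c cover_disjoint[OF cov w(1)] by fastforce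
  moreover have "finite I"
    using I_S S \<open>finite (verts H)\<close> by (meson finite_subset)
  ultimately have "card (insert c I) = Suc (card ?W)"
    using I by (simp add: cover_coloring_def)
  also have "\<dots> = card (verts G)"
    using card.remove[OF _ w(1)] G by (simp add: graph_def)
  finally show "\<exists>I. cover_coloring G H I"
    using ind' by (auto simp: cover_coloring_def)
qed simp

subsection \<open>Joins with complete graphs\<close>

lemma verts_join: "verts (join G (complete_graph p)) = verts G <+> {1..p}"
  by (simp add: join_def complete_graph_def)

lemma card_verts_join:
  assumes "graph G"
  shows "card (verts (join G (complete_graph p))) = card (verts G) + p"
  using assms by (simp add: verts_join graph_def card_Plus)

lemma edges_join_iff:
  shows "{Inl u, Inl v} \<in> edges (join G (complete_graph p)) \<longleftrightarrow> {u, v} \<in> edges G"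
    and "{Inr i, Inr j} \<in> edges (join G (complete_graph p)) \<longleftrightarrow> i \<noteq> j \<and> i \<in> {1..p} \<and> j \<in> {1..p}"
    and "{Inl u, Inr i} \<in> edges (join G (complete_graph p)) \<longleftrightarrow> u \<in> verts G \<and> i \<in> {1..p}"
    and "{Inr i, Inl u} \<in> edges (join G (complete_graph p)) \<longleftrightarrow> u \<in> verts G \<and> i \<in> {1..p}"
proof -
  have l: "{Inl u, Inl v} = Inl ` e \<longleftrightarrow> e = {u, v}" for e :: "'a set" and u v
    using inj_image_eq_iff[OF inj_Inl, of "{u, v}" e] by auto
  have r: "{Inr i, Inr j} = Inr ` e \<longleftrightarrow> e = {i, j}" for e :: "nat set" and i j
    using inj_image_eq_iff[OF inj_Inr, of "{i, j}" e] by auto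
  show "{Inl u, Inl v} \<in> edges (join G (complete_graph p)) \<longleftrightarrow> {u, v} \<in> edges G"
    by (auto simp: join_def complete_graph_def image_iff l doubleton_eq_iff)
  show "{Inr i, Inr j} \<in> edges (join G (complete_graph p)) \<longleftrightarrow> i \<noteq> j \<and> i \<in> {1..p} \<and> j \<in> {1..p}"
    by (auto simp: join_def complete_graph_def image_iff r doubleton_eq_iff nsets_def card_insert_if)
  show "{Inl u, Inr i} \<in> edges (join G (complete_graph p)) \<longleftrightarrow> u \<in> verts G \<and> i \<in> {1..p}"
    by (auto simp: join_def complete_graph_def doubleton_eq_iff)
  then show "{Inr i, Inl u} \<in> edges (join G (complete_graph p)) \<longleftrightarrow> u \<in> verts G \<and> i \<in> {1..p}"
    by (simp add: insert_commute)
qed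

lemma graph_join:
  assumes "graph G"
  shows "graph (join G (complete_graph p))"
proof -
  have "e \<in> [verts G <+> {1..p}]\<^bsup>2\<^esup>" if "e \<in> edges (join G (complete_graph p))" for e
  proof -
    from that consider d where "e = Inl ` d" "d \<in> edges G"
      | d where "e = Inr ` d" "d \<in> [{1..p}]\<^bsup>2\<^esup>"
      | u i where "e = {Inl u, Inr i}" "u \<in> verts G" "i \<in> {1..p}"
      unfolding join_def complete_graph_def by auto
    then show ?thesis
    proof cases
      case 1
      then have "d \<subseteq> verts G" "finite d" "card d = 2"
        using assms by (auto simp: graph_def nsets_def)
      then show ?thesis using 1 by (auto simp: nsets_def card_image)
    next
      case 2
      then show ?thesis by (auto simp: nsets_def card_image)
    next
      case 3
      then show ?thesis by (simp add: nsets_def InlI InrI card_insert_if)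
    qed
  qed
  then show ?thesis
    using assms by (auto simp: graph_def verts_join)
qed

text \<open>An equality, not just an isomorphism, because the vertex set \<open>{1..q}\<close> is an
  initial part of \<open>{1..p}\<close>.\<close>

lemma induced_join:
  assumes G: "graph G" and "q \<le> p"
  shows "induced (join G (complete_graph p)) (verts (join G (complete_graph q)))
    = join G (complete_graph q)"
proof -
  have "e \<in> edges (join G (complete_graph p)) \<and> e \<subseteq> verts G <+> {1..q}
      \<longleftrightarrow> e \<in> edges (join G (complete_graph q))" (is "?l \<longleftrightarrow> ?r") for e
  proof -
    have E: "\<exists>x y. e = {x, y} \<and> x \<in> verts J \<and> y \<in> verts J"
      if "graph J" "e \<in> edges J" for J :: "('a + nat) ugraph" and e
    proof -
      have "e \<subseteq> verts J" "card e = 2"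
        using that by (auto simp: graph_def nsets_def)
      then show ?thesis by (auto simp: card_2_iff)
    qed
    have "\<exists>x y. e = {x, y}" if "?l \<or> ?r"
      using that E graph_join[OF G] by metis
    moreover have "e \<subseteq> verts G <+> {1..q}" if "?r"
      using E[OF graph_join[OF G] that] by (auto simp: verts_join)
    moreover have "?l \<longleftrightarrow> ?r" if "e = {x, y}" "e \<subseteq> verts G <+> {1..q}" for x y
      using that \<open>q \<le> p\<close> by (cases x; cases y) (auto simp: edges_join_iff)
    ultimately show ?thesis by blast
  qed
  then show ?thesis
    by (auto simp: induced_def verts_join intro!: ugraph.equality)
qed

lemma DP_chromatic_number_join_Suc:
  assumes G: "graph G"
  shows "DP_chromatic_number (join G (complete_graph (Suc p)))
    \<le> Suc (DP_chromatic_number (join G (complete_graph p)))"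
proof (rule DP_chromatic_number_le, rule DP_colorable_add_vertex[OF graph_join[OF G]])
  have *: "verts (join G (complete_graph (Suc p))) - {Inr (Suc p)} = verts (join G (complete_graph p))"
    by (auto simp: verts_join)
  show "Inr (Suc p) \<in> verts (join G (complete_graph (Suc p)))"
    by (auto simp: verts_join)
  show "verts (join G (complete_graph (Suc p))) - {Inr (Suc p)} \<noteq> {}"
    using graph_join[OF G] unfolding * by (simp add: graph_def)
  show "DP_colorable (DP_chromatic_number (join G (complete_graph p)))
      (induced (join G (complete_graph (Suc p)))
        (verts (join G (complete_graph (Suc p))) - {Inr (Suc p)}))"
    unfolding * using DP_colorable_chromatic_number[OF graph_join[OF G]]
    by (simp add: induced_join[OF G])
qed

lemma DP_chromatic_number_join_ge:
  assumes G: "graph G"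
  shows "p \<le> DP_chromatic_number (join G (complete_graph p))"
proof -
  have "card (Inr ` {1..p} :: ('a + nat) set) \<le> DP_chromatic_number (join G (complete_graph p))"
    by (rule clique_le_DP_chromatic_number[OF graph_join[OF G]])
       (auto simp: verts_join clique_def edges_join_iff)
  then show ?thesis by (simp add: card_image)
qed

text \<open>The join is then itself complete. Used contrapositively: a smaller DP-chromatic number
  yields two non-adjacent vertices of \<open>G\<close>.\<close>

lemma DP_chromatic_number_join_complete:
  assumes G: "graph G" and "clique (verts G) (edges G)"
  shows "card (verts G) + p \<le> DP_chromatic_number (join G (complete_graph p))"
proof -
  have "{x, y} \<in> edges (join G (complete_graph p))"
    if "x \<in> verts G <+> {1..p}" "y \<in> verts G <+> {1..p}" "x \<noteq> y" for x y
    using that assms(2) by (cases x; cases y) (auto simp: clique_def edges_join_iff)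
  then have "clique (verts (join G (complete_graph p))) (edges (join G (complete_graph p)))"
    by (simp add: verts_join clique_def)
  then show ?thesis
    using clique_le_DP_chromatic_number[OF graph_join[OF G] order_refl]
    by (simp add: card_verts_join[OF G])
qed

section \<open>Stabilisation and the choice of \<open>p\<close>\<close>

text \<open>The difference \<open>D q - q\<close> never increases, so from a point \<open>p0\<close>
  where it is minimal it stays constant. The subtraction is exact by \<open>ge\<close>.\<close>

lemma eventually_affine:
  fixes D :: "nat \<Rightarrow> nat"
  assumes ge: "\<And>p. p \<le> D p" and Suc: "\<And>p. D (Suc p) \<le> Suc (D p)"
  shows "\<exists>p0 s. \<forall>q\<ge>p0. D q = q + s"
proof -
  define p0 where "p0 = (ARG_MIN (\<lambda>q. D q - q) q. True)"
  have p0: "D p0 - p0 \<le> D q - q" for q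
    unfolding p0_def by (rule arg_min_nat_le) simp
  have "D q = q + (D p0 - p0)" if "p0 \<le> q" for q
  proof -
    have "D q + p0 \<le> D p0 + q"
      using that
    proof (induction q rule: dec_induct)
      case (step q)
      then show ?case using Suc[of q] by simp
    qed simp
    then show ?thesis using p0[of q] ge[of q] ge[of p0] by simp
  qed
  then show ?thesis by blast
qed

theorem theorem9:
  fixes G :: "'a ugraph"
  assumes "graph G"
  shows "\<exists>p\<ge>1. partially_DP_nice (join G (complete_graph p))"
proof -
  note G = assms
  let ?J = "\<lambda>p. join G (complete_graph p)"
  let ?D = "\<lambda>p. DP_chromatic_number (?J p)"
  let ?n = "card (verts G)"
  obtain p0 s where D: "\<And>q. p0 \<le> q \<Longrightarrow> ?D q = q + s"
    using eventually_affine[of ?D, OF DP_chromatic_number_join_ge[OF G]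
      DP_chromatic_number_join_Suc[OF G]] by blast
  have "?D p0 \<le> ?n + p0"
    using DP_chromatic_number_le[OF DP_colorable_order[OF graph_join[OF G]]]
    by (metis card_verts_join[OF G])
  \<comment> \<open>For every q \<ge> \<open>p0\<close>, \<open>d\<close> is the order of
    \<open>?J q\<close> minus its DP-chromatic number.\<close>
  then obtain d where d: "?n = s + d"
    using D[of p0] by (metis add.commute add_le_cancel_left le_Suc_ex order_refl)
  \<comment> \<open>For \<open>t < p0 + s\<close> this gives both \<open>t < p\<close> and
    \<open>t * d \<le> p + s\<close>; \<open>Suc\<close> makes \<open>p\<close> positive.\<close>
  define p where "p = Suc (p0 + s + (p0 + s) * d)"
  have Dp: "?D p = p + s" using D by (simp add: p_def)
  \<comment> \<open>The required inequality with the denominator \<open>?D p\<close> cleared, so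
    that it lives in \<open>nat\<close>.\<close>
  have bound: "t * (?n + p) \<le> partial_DP_number t (?J p) * (p + s)" (is "_ \<le> ?a * _")
    if t: "1 \<le> t" "t \<le> p + s" for t
  proof (cases "p0 + s \<le> t")
    case True
    \<comment> \<open>Chosen so that \<open>?D q = t\<close>, which holds because
      \<open>p0 \<le> q\<close>.\<close>
    define q where "q = t - s"
    have q: "t = q + s" "p0 \<le> q" "q \<le> p" using True t by (auto simp: q_def)
    have "card (verts (?J q)) \<le> ?a"
    proof (rule partial_DP_number_ge_induced[OF graph_join[OF G]])
      show "verts (?J q) \<subseteq> verts (?J p)" using q by (auto simp: verts_join)
      show "verts (?J q) \<noteq> {}" using graph_join[OF G] by (simp add: graph_def)
      show "DP_colorable t (induced (?J p) (verts (?J q)))"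
        using DP_colorable_chromatic_number[OF graph_join[OF G], of q] D[OF q(2)] q
        by (simp add: induced_join[OF G])
    qed
    then have "t + d \<le> ?a" using d q by (simp add: card_verts_join[OF G])
    \<comment> \<open>As \<open>?n = s + d\<close>, the left side is
      \<open>t * (p + s) + t * d\<close>, and \<open>t \<le> p + s\<close>.\<close>
    moreover have "t * (?n + p) \<le> (t + d) * (p + s)"
      using d mult_le_mono1[OF t(2), of d] by (simp add: algebra_simps)
    ultimately show ?thesis by (meson le_trans mult_le_mono1)
  next
    case False
    have tp: "t < card (verts (?J p))"
      using False by (simp add: card_verts_join[OF G] p_def)
    show ?thesis
    \<comment> \<open>If \<open>d = 0\<close>, then \<open>?n + p = p + s\<close> and the bound to
      reach is just \<open>t\<close>; otherwise one more vertex is gained from a non-adjacent pair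
      in \<open>G\<close>.\<close>
    proof (cases "d = 0")
      case True
      have "t \<le> ?a"
        using partial_DP_number_ge[OF graph_join[OF G] t(1)]
          fold_cover_independence_ge tp less_imp_le by metis
      then show ?thesis using d True by (simp add: add.commute)
    next
      case d_pos: False
      then have "\<not> clique (verts G) (edges G)"
        using DP_chromatic_number_join_complete[OF G, of p] Dp d by auto
      then obtain u v where uv: "u \<in> verts G" "v \<in> verts G" "u \<noteq> v" "{u, v} \<notin> edges G"
        by (auto simp: clique_def)
      have "Suc t \<le> ?a"
      proof (rule partial_DP_number_ge[OF graph_join[OF G] t(1)])
        fix L and H :: "nat ugraph" assume "fold_cover t (?J p) L H"
        then show "Suc t \<le> independence_number H"
          using fold_cover_independence_ge_Suc[OF _ t(1) tp, of L H "Inl u" "Inl v"] uv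
          by (simp add: verts_join edges_join_iff InlI)
      qed
      \<comment> \<open>The excess \<open>t * d\<close> of \<open>t * (?n + p)\<close> over
        \<open>t * (p + s)\<close> is at most \<open>p + s\<close> by the choice of
        \<open>p\<close>, so \<open>Suc t\<close> suffices.\<close>
      moreover have "t * d \<le> (p0 + s) * d"
        using False by (intro mult_le_mono1) simp
      then have "t * d \<le> p + s"
        unfolding p_def by linarith
      then have "t * (?n + p) \<le> Suc t * (p + s)"
        using d by (simp add: algebra_simps)
      ultimately show ?thesis by (meson le_trans mult_le_mono1)
    qed
  qed
  have "real t * real (card (verts (?J p))) / real (?D p) \<le> real (partial_DP_number t (?J p))"
    if "t \<in> {1..?D p}" for t
  proof -
    have "real (t * (?n + p)) \<le> real (partial_DP_number t (?J p) * (p + s))"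
      using bound that Dp by (intro of_nat_mono) simp
    moreover have "0 < p" by (simp add: p_def)
    ultimately show ?thesis
      by (simp add: Dp card_verts_join[OF G] pos_divide_le_eq)
  qed
  then have "partially_DP_nice (?J p)" by (simp add: partially_DP_nice_def)
  then show ?thesis by (intro exI[of _ p]) (simp add: p_def)
qed

end
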